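(* Let $S=\langle L,\leq,\top,\bot,\Box,\boxtimes\rangle$ be a meet APS satisfying the following two conditions: for all $x,y,z\in L$, if $x\leq\Box y$ and $x\leq\boxtimes(y\land z)$, then $x\leq\boxtimes z$; and for every $x\in L$ there exists $p\in L$ such that $p=\boxtimes(p\land x)$. Then for every $x\in L$, if $(\boxtimes x\land x)\leq\bot$, then $x\leq\bot$.
   Context: An abstract provability structure (APS) is a tuple $S=\langle L,\leq,\top,\bot,\Box,\boxtimes\rangle$ where $L$ is a nonempty set, $\leq$ is a partial order on $L$, $\top,\bot\in L$, and $\Box,\boxtimes$ are unary operations on $L$ such that for all $x,y\in L$: (C1) if $x\leq y$ then $\Box x\leq\Box y$ and $\boxtimes y\leq\boxtimes x$; (C2) $\top\leq\boxtimes\bot$; (C3) if $x\leq\Box y$ and $x\leq\boxtimes y$ then $x\leq\boxtimes\top$; (C4) $\boxtimes x\leq\Box\boxtimes x$; (C5) $x\leq\top$. (It is not assumed that $\bot$ is the least element.) A meet APS is an APS for which $\langle L,\leq\rangle$ is a meet-semilattice; $x\land y$ denotes the meet. *)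

theory Defs
  imports Main
begin

text \<open>
  The carrier of an abstract provability structure is a type of class \<open>order\<close>.
  The constants \<open>tp\<close> (\<open>\<top>\<close>) and \<open>bt\<close> (\<open>\<bottom>\<close>) are parameters rather than the class constants
  \<open>top\<close> and \<open>bot\<close>: only \<open>tp\<close> is required to be extremal; \<open>bt\<close> need not be the least element.
\<close>

locale aps =
  fixes tp bt :: "'a::order"
    and box :: "'a \<Rightarrow> 'a"  (\<open>\<box> _\<close> [80] 80)
    and rbox :: "'a \<Rightarrow> 'a"  (\<open>\<boxtimes> _\<close> [80] 80)
  assumes C1_box: "x \<le> y \<Longrightarrow> \<box> x \<le> \<box> y"
    and C1_rbox: "x \<le> y \<Longrightarrow> \<boxtimes> y \<le> \<boxtimes> x"
    and C2: "tp \<le> \<boxtimes> bt"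
    and C3: "x \<le> \<box> y \<Longrightarrow> x \<le> \<boxtimes> y \<Longrightarrow> x \<le> \<boxtimes> tp"
    and C4: "\<boxtimes> x \<le> \<box> \<boxtimes> x"
    and C5: "x \<le> tp"

locale meet_aps = aps tp bt box rbox
  for tp bt :: "'a::semilattice_inf"
    and box :: "'a \<Rightarrow> 'a"  (\<open>\<box> _\<close> [80] 80)
    and rbox :: "'a \<Rightarrow> 'a"  (\<open>\<boxtimes> _\<close> [80] 80)

end

theory Submission
  imports Defs
begin

text \<open>
  Let \<open>p = \<boxtimes>(p \<and> x)\<close> be a Goedel-style fixed point for \<open>x\<close>. Then \<open>p \<le> \<box>p\<close>, so the first
  hypothesis gives \<open>p \<le> \<boxtimes>x\<close>, whence \<open>p \<and> x \<le> \<bottom>\<close>. Applying \<open>\<boxtimes>\<close> shows \<open>\<top> \<le> p \<le> \<boxtimes>x\<close>,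
  so \<open>x = \<boxtimes>x \<and> x \<le> \<bottom>\<close>.
\<close>

theorem theorem7p14:
  fixes tp bt :: "'a::semilattice_inf"
    and box :: "'a \<Rightarrow> 'a"  (\<open>\<box> _\<close> [80] 80)
    and rbox :: "'a \<Rightarrow> 'a"  (\<open>\<boxtimes> _\<close> [80] 80)
  assumes "meet_aps tp bt box rbox"
    and "\<And>x y z. x \<le> \<box> y \<Longrightarrow> x \<le> \<boxtimes> (inf y z) \<Longrightarrow> x \<le> \<boxtimes> z"
    and "\<And>x. \<exists>p. p = \<boxtimes> (inf p x)"
  shows "\<forall>x. inf (\<boxtimes> x) x \<le> bt \<longrightarrow> x \<le> bt"
proof (intro allI impI)
  interpret meet_aps tp bt box rbox by fact
  fix x
  assume x: "inf (\<boxtimes> x) x \<le> bt"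
  obtain p where p: "p = \<boxtimes> (inf p x)"
    using assms(3) by blast
  \<comment> \<open>\<open>p\<close> is a value of \<open>\<boxtimes>\<close>, and C4 puts every
    such value below its own box.\<close>
  have "p \<le> \<box> p"
    using C4[of "inf p x"] p by simp
  \<comment> \<open>The first hypothesis is used with \<open>p\<close>, \<open>p\<close>,
    \<open>x\<close> for its \<open>x\<close>, \<open>y\<close>, \<open>z\<close>; its second
    premise is the fixed point equation read as an inequality.\<close>
  then have px: "p \<le> \<boxtimes> x"
    using assms(2) p by (metis order_refl)
  then have "inf p x \<le> bt"
    using x by (meson inf_mono order_refl order_trans)
  then have "\<boxtimes> bt \<le> p"
    using C1_rbox p by metis
  \<comment> \<open>The chain is
    \<open>x \<le> tp \<le> \<boxtimes> bt \<le> p \<le> \<boxtimes> x\<close>; in particular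
    \<open>p\<close> equals \<open>tp\<close>.\<close>
  then have "x \<le> \<boxtimes> x"
    using C5[of x] C2 px by (meson order_trans)
  then show "x \<le> bt"
    using x by (simp add: inf_absorb2)
qed

end
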